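(* Let $d$ be a positive integer and $\chi$ a primitive Dirichlet character of conductor $d$. Let $w_1,w_2,w_3$ be any positive integers, $y_1,y_2\in\mathbb{Z}_p$, and $n\ge0$ an integer. Then \begin{align*} &\sum_{k+l+m=n}\binom{n}{k,l,m}B_{k,\chi}(w_{1}y_{1})B_{l,\chi}(w_{2}y_{2})S_{m}(w_{3}d-1,\chi)w_{1}^{l+m}w_{2}^{k+m}w_{3}^{k+l-1}\\ =&\sum_{k+l+m=n}\binom{n}{k,l,m}B_{k,\chi}(w_{1}y_{1})B_{l,\chi}(w_{3}y_{2})S_{m}(w_{2}d-1,\chi)w_{1}^{l+m}w_{3}^{k+m}w_{2}^{k+l-1}\\ =&\sum_{k+l+m=n}\binom{n}{k,l,m}B_{k,\chi}(w_{2}y_{1})B_{l,\chi}(w_{1}y_{2})S_{m}(w_{3}d-1,\chi)w_{2}^{l+m}w_{1}^{k+m}w_{3}^{k+l-1}\\ =&\sum_{k+l+m=n}\binom{n}{k,l,m}B_{k,\chi}(w_{2}y_{1})B_{l,\chi}(w_{3}y_{2})S_{m}(w_{1}d-1,\chi)w_{2}^{l+m}w_{3}^{k+m}w_{1}^{k+l-1}\\ =&\sum_{k+l+m=n}\binom{n}{k,l,m}B_{k,\chi}(w_{3}y_{1})B_{l,\chi}(w_{2}y_{2})S_{m}(w_{1}d-1,\chi)w_{3}^{l+m}w_{2}^{k+m}w_{1}^{k+l-1}\\ =&\sum_{k+l+m=n}\binom{n}{k,l,m}B_{k,\chi}(w_{3}y_{1})B_{l,\chi}(w_{1}y_{2})S_{m}(w_{2}d-1,\chi)w_{3}^{l+m}w_{1}^{k+m}w_{2}^{k+l-1}.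 \end{align*}
   Context: $p$ is a fixed prime, $\mathbb{Z}_p$ the $p$-adic integers; algebraic numbers are viewed in $\mathbb{C}_p$ via a fixed embedding $\overline{\mathbb{Q}}\to\mathbb{C}_p$. The character $\chi$ is regarded as a function on integers (periodic mod $d$, with $\chi(a)=0$ when $\gcd(a,d)>1$; for $d=1$, $\chi\equiv 1$). The generalized Bernoulli polynomials are defined by $\frac{te^{xt}}{e^{dt}-1}\sum_{a=0}^{d-1}\chi(a)e^{at}=\sum_{n\ge0}B_{n,\chi}(x)\frac{t^n}{n!}$. The generalized power sum is $S_k(N,\chi)=\sum_{a=0}^{N}\chi(a)a^k$ (with $0^0=1$). Sums are over nonnegative integers $k,l,m$ with $k+l+m=n$, and $\binom{n}{k,l,m}=\frac{n!}{k!l!m!}$. *)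

theory Defs
  imports "HOL-Analysis.Analysis"
    "HOL-Computational_Algebra.Computational_Algebra"
begin

(* The type 'a, with its metric, is a model of C_p, the completion of an algebraic closure of Q_p.
   Completeness comes from the class complete_space; the absolute value of x is dist x 0. *)

definition padic_abs :: "'a::{field_char_0,complete_space} \<Rightarrow> real" where
  "padic_abs x = dist x 0"

(* Since 'a is complete, closures of subsets of 'a are completions. *)

definition padic_integers :: "'a::{field_char_0,complete_space} set" where
  "padic_integers = closure \<int>"

definition padic_numbers :: "'a::{field_char_0,complete_space} set" where
  "padic_numbers = closure \<rat>"

definition padic_algebraic :: "'a::{field_char_0,complete_space} set" where
  "padic_algebraic = {x. \<exists>q. q \<noteq> 0 \<and> (\<forall>i. coeff q i \<in> padic_numbers) \<and> poly q x = 0}"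

(* A multiplicative ultrametric absolute value with |p| = 1/p restricts to the usual p-adic
   absolute value on the rationals.  The last two conditions say that the elements algebraic
   over Q_p form an algebraically closed field, and that 'a is its completion. *)

definition is_complex_padic_field :: "nat \<Rightarrow> 'a::{field_char_0,complete_space} itself \<Rightarrow> bool" where
  "is_complex_padic_field p (T :: 'a itself) \<longleftrightarrow>
     (\<forall>x y :: 'a. dist x y = padic_abs (x - y)) \<and>
     (\<forall>x y :: 'a. padic_abs (x * y) = padic_abs x * padic_abs y) \<and>
     (\<forall>x y :: 'a. padic_abs (x + y) \<le> max (padic_abs x) (padic_abs y)) \<and>
     padic_abs (of_nat p :: 'a) = 1 / real p \<and>
     (\<forall>q :: 'a poly. (\<forall>i. coeff q i \<in> padic_algebraic) \<longrightarrow> degree q > 0 \<longrightarrow>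
        (\<exists>x \<in> padic_algebraic. poly q x = 0)) \<and>
     closure (padic_algebraic :: 'a set) = UNIV"

(* Only the values of \<iota> on algebraic numbers matter. *)

definition is_embedding_of_algebraic_numbers :: "(complex \<Rightarrow> 'a::field) \<Rightarrow> bool" where
  "is_embedding_of_algebraic_numbers \<iota> \<longleftrightarrow>
     \<iota> 1 = 1 \<and> inj_on \<iota> {x. algebraic x} \<and>
     (\<forall>x y. algebraic x \<longrightarrow> algebraic y \<longrightarrow>
        \<iota> (x + y) = \<iota> x + \<iota> y \<and> \<iota> (x * y) = \<iota> x * \<iota> y)"

definition dirichlet_character :: "nat \<Rightarrow> (int \<Rightarrow> complex) \<Rightarrow> bool" where
  "dirichlet_character d chi \<longleftrightarrow> d > 0 \<and>
     (\<forall>a. chi (a + int d) = chi a) \<and>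
     (\<forall>a b. chi (a * b) = chi a * chi b) \<and>
     (\<forall>a. chi a = 0 \<longleftrightarrow> \<not> coprime a (int d))"

definition induced_from :: "nat \<Rightarrow> nat \<Rightarrow> (int \<Rightarrow> complex) \<Rightarrow> bool" where
  "induced_from d e chi \<longleftrightarrow> e dvd d \<and>
     (\<exists>\<psi>. dirichlet_character e \<psi> \<and> (\<forall>a. coprime a (int d) \<longrightarrow> chi a = \<psi> a))"

definition char_conductor :: "nat \<Rightarrow> (int \<Rightarrow> complex) \<Rightarrow> nat" where
  "char_conductor d chi = (LEAST e. induced_from d e chi)"

definition primitive_character :: "nat \<Rightarrow> (int \<Rightarrow> complex) \<Rightarrow> bool" where
  "primitive_character d chi \<longleftrightarrow> dirichlet_character d chi \<and> char_conductor d chi = d"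

(* The quotient is one of formal power series in t: the denominator has order 1 at t = 0,
   and the numerator has order at least 1. *)

definition bernoulli_chi_fps :: "(int \<Rightarrow> 'a::field_char_0) \<Rightarrow> nat \<Rightarrow> 'a \<Rightarrow> 'a fps" where
  "bernoulli_chi_fps chi d x =
     (fps_X * fps_exp x) * (\<Sum>a<d. fps_const (chi (int a)) * fps_exp (of_nat a))
       / (fps_exp (of_nat d) - 1)"

definition bernoulli_chi :: "(int \<Rightarrow> 'a::field_char_0) \<Rightarrow> nat \<Rightarrow> nat \<Rightarrow> 'a \<Rightarrow> 'a" where
  "bernoulli_chi chi d n x = fact n * fps_nth (bernoulli_chi_fps chi d x) n"

definition power_sum_chi :: "(int \<Rightarrow> 'a::field_char_0) \<Rightarrow> nat \<Rightarrow> nat \<Rightarrow> 'a" where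
  "power_sum_chi chi k N = (\<Sum>a\<le>N. chi (int a) * of_nat a ^ k)"

definition multinomial3 :: "nat \<Rightarrow> nat \<Rightarrow> nat \<Rightarrow> nat \<Rightarrow> 'a::field_char_0" where
  "multinomial3 n k l m = fact n / (fact k * fact l * fact m)"

lemma bernoulli_chi_fps_generating:
  assumes "d > 0"
  shows "(fps_exp (of_nat d) - 1) * Abs_fps (\<lambda>n. bernoulli_chi chi d n x / fact n) =
    fps_X * fps_exp x * (\<Sum>a<d. fps_const (chi (int a)) * fps_exp (of_nat a))"
proof -
  let ?g = "fps_exp (of_nat d) - 1 :: 'a fps"
  let ?h = "fps_exp x * (\<Sum>a<d. fps_const (chi (int a)) * fps_exp (of_nat a))"
  have nz: "fps_nth ?g 1 \<noteq> 0" and z: "fps_nth ?g 0 = 0" using assms by auto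
  then have sd: "subdegree ?g = 1"
    by (intro subdegreeI) auto
  have g0: "?g \<noteq> 0" using nz by auto
  have "?g dvd fps_X * ?h"
  proof (cases "?h = 0")
    case True
    then show ?thesis by simp
  next
    case False
    then show ?thesis
      using g0 sd by (subst fps_dvd_iff) simp_all
  qed
  moreover have "Abs_fps (\<lambda>n. bernoulli_chi chi d n x / fact n) = (fps_X * ?h) / ?g"
    by (intro fps_ext) (simp add: bernoulli_chi_def bernoulli_chi_fps_def mult.assoc)
  ultimately show ?thesis
    by (simp add: mult.assoc)
qed

end

theory Submission
  imports Defs
begin

text \<open>Put \<open>A(t) = \<Sum>a<d. \<chi>(a) e^(at)\<close> and \<open>D(t) = e^(dt) - 1\<close>. The generating function of
  \<open>B\<^bsub>n,\<chi>\<^esub>(x)\<close> is \<open>t e^(xt) A(t) / D(t)\<close>, and by periodicity of \<open>\<chi>\<close> that of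
  \<open>S\<^bsub>n\<^esub>(wd - 1, \<chi>)\<close> is \<open>D(wt) A(t) / D(t)\<close>. Hence, with \<open>W = w\<^sub>1w\<^sub>2w\<^sub>3\<close>, the exponential generating function
  of the first sum is
  \<open>W t^2 e^(W(y\<^sub>1 + y\<^sub>2)t) D(Wt) \<Prod> A(w\<^sub>iw\<^sub>jt) / \<Prod> D(w\<^sub>iw\<^sub>jt)\<close>, the products ranging over \<open>i < j\<close>,
  and this is symmetric in \<open>w\<^sub>1, w\<^sub>2, w\<^sub>3\<close>.\<close>

text \<open>The parameter \<open>c\<close>, here and in \<open>bernoulli_egf\<close>, builds in the
  substitution t -> ct, so that the rescaled series A(ct) can be multiplied without composing power
  series.\<close>

definition char_exp_sum :: "(int \<Rightarrow> 'a::field_char_0) \<Rightarrow> nat \<Rightarrow> 'a \<Rightarrow> 'a fps" where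
  "char_exp_sum chi N c = (\<Sum>a<N. fps_const (chi (int a)) * fps_exp (of_nat a * c))"

definition bernoulli_egf :: "(int \<Rightarrow> 'a::field_char_0) \<Rightarrow> nat \<Rightarrow> 'a \<Rightarrow> 'a \<Rightarrow> 'a fps" where
  "bernoulli_egf chi d x c = Abs_fps (\<lambda>n. bernoulli_chi chi d n x * c ^ n / fact n)"

text \<open>All six sums of the theorem are values of this function: \<open>u\<close>,
  \<open>v\<close>, \<open>w\<close> run through the permutations of the three weights, while
  \<open>y\<close> and \<open>z\<close> keep their places.\<close>

definition symmetric_sum ::
    "(int \<Rightarrow> 'a::field_char_0) \<Rightarrow> nat \<Rightarrow> nat \<Rightarrow> 'a \<Rightarrow> 'a \<Rightarrow> nat \<Rightarrow> nat \<Rightarrow> nat \<Rightarrow> 'a" where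
  "symmetric_sum chi d n y z u v w = (\<Sum>(k,l,m) \<in> {(k,l,m). k + l + m = n}. multinomial3 n k l m *
     bernoulli_chi chi d k (of_nat u * y) * bernoulli_chi chi d l (of_nat v * z) *
     power_sum_chi chi m (w * d - 1) *
     of_nat u ^ (l + m) * of_nat v ^ (k + m) * of_nat w powi (int k + int l - 1))"

text \<open>Substitute t -> ct in \<open>bernoulli_chi_fps_generating\<close>. The product form
  avoids division by a series without constant term.\<close>

lemma bernoulli_egf_generating:
  assumes "d > 0"
  shows "(fps_exp (of_nat d * c) - 1) * bernoulli_egf chi d x c =
    fps_const c * fps_X * fps_exp (x * c) * char_exp_sum chi d c"
proof -
  let ?L = "fps_const c * fps_X"
  \<comment> \<open>A zero constant term is what makes composition with \<open>?L\<close>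
    multiplicative.\<close>
  have L0: "fps_nth ?L 0 = 0" by simp
  have egf: "bernoulli_egf chi d x c =
      fps_compose (Abs_fps (\<lambda>n. bernoulli_chi chi d n x / fact n)) ?L"
    by (simp add: bernoulli_egf_def fps_compose_linear fps_eq_iff)
  have "(fps_exp (of_nat d * c) - 1) * bernoulli_egf chi d x c =
      fps_compose ((fps_exp (of_nat d) - 1) * Abs_fps (\<lambda>n. bernoulli_chi chi d n x / fact n)) ?L"
    by (simp add: egf fps_compose_mult_distrib[OF L0] fps_compose_sub_distrib
        mult.commute[of c])
  also have "\<dots> = fps_compose (fps_X * fps_exp x *
      (\<Sum>a<d. fps_const (chi (int a)) * fps_exp (of_nat a))) ?L"
    by (simp only: bernoulli_chi_fps_generating[OF assms])
  also have "\<dots> = ?L * fps_exp (x * c) * char_exp_sum chi d c"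
    by (simp add: fps_compose_mult_distrib[OF L0] fps_compose_sum_distrib
        char_exp_sum_def mult.commute[of c])
  finally show ?thesis by simp
qed

lemma fps_nth_char_exp_sum:
  assumes "N > 0"
  shows "fps_nth (char_exp_sum chi N c) m = power_sum_chi chi m (N - 1) * c ^ m / fact m"
proof -
  \<comment> \<open>\<open>power_sum_chi\<close> includes its upper bound. At \<open>N = 0\<close>
    truncated subtraction would leave the term a = 0.\<close>
  have "{..<N} = {..N - 1}" using assms by auto
  then show ?thesis
    by (simp add: char_exp_sum_def power_sum_chi_def fps_sum_nth sum_distrib_right
        sum_divide_distrib power_mult_distrib mult.assoc)
qed

text \<open>Cut the range into \<open>w\<close> blocks of length \<open>d\<close>. By periodicity
  block j contributes e^(jdct) A(ct), and the geometric sum over j is D(wct) / D(ct). The induction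
  adds one block at a time.\<close>

lemma char_exp_sum_periodic:
  assumes per: "\<And>a. chi (a + int d) = chi a"
  shows "(fps_exp (of_nat d * c) - 1) * char_exp_sum chi (w * d) c =
    (fps_exp (of_nat w * (of_nat d * c)) - 1) * char_exp_sum chi d c"
proof (induction w)
  case 0
  then show ?case by (simp add: char_exp_sum_def)
next
  case (Suc w)
  have per': "chi (int w * int d + int a) = chi (int a)" for a
  proof (induction w)
    case (Suc w)
    then show ?case using per[of "int w * int d + int a"] by (simp add: algebra_simps)
  qed simp
  have "char_exp_sum chi (Suc w * d) c =
      char_exp_sum chi (w * d) c + (\<Sum>a<d. fps_const (chi (int (w * d + a))) * fps_exp (of_nat (w * d + a) * c))"
    unfolding char_exp_sum_def lessThan_atLeast0
    using sum.atLeastLessThan_concat[of 0 "w * d" "Suc w * d"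
        "\<lambda>a. fps_const (chi (int a)) * fps_exp (of_nat a * c)"]
      sum.shift_bounds_nat_ivl[of "\<lambda>a. fps_const (chi (int a)) * fps_exp (of_nat a * c)" 0 "w * d" d]
    by (simp add: add.commute)
  also have "(\<Sum>a<d. fps_const (chi (int (w * d + a))) * fps_exp (of_nat (w * d + a) * c)) =
      fps_exp (of_nat w * (of_nat d * c)) * char_exp_sum chi d c"
    unfolding char_exp_sum_def sum_distrib_left
    by (rule sum.cong) (simp_all only: of_nat_add per' of_nat_mult distrib_right
        fps_exp_add_mult mult.assoc mult.left_commute)
  finally have step: "char_exp_sum chi (Suc w * d) c =
      char_exp_sum chi (w * d) c + fps_exp (of_nat w * (of_nat d * c)) * char_exp_sum chi d c" .
  have "fps_exp (of_nat (Suc w) * (of_nat d * c)) =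
      fps_exp (of_nat d * c) * fps_exp (of_nat w * (of_nat d * c))"
    by (simp add: distrib_right fps_exp_add_mult)
  \<comment> \<open>With E = e^(dct) the step is (E^w - 1) + (E - 1) E^w = E^(w+1) - 1.\<close>
  then show ?case
    unfolding step distrib_left Suc.IH by (simp add: algebra_simps)
qed

lemma fps_nth_mult3:
  fixes f g h :: "'a::semiring_0 fps"
  shows
  "fps_nth (f * g * h) n =
    (\<Sum>(k,l,m) \<in> {(k,l,m). k + l + m = n}. fps_nth f k * fps_nth g l * fps_nth h m)"
proof -
  have "fps_nth (f * g * h) n =
      (\<Sum>k=0..n. \<Sum>l=0..n - k. fps_nth f k * fps_nth g l * fps_nth h (n - k - l))"
    unfolding mult.assoc[of f g h] by (simp add: fps_mult_nth sum_distrib_left mult.assoc)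
  also have "\<dots> = (\<Sum>(k,l) \<in> Sigma {0..n} (\<lambda>k. {0..n - k}).
      fps_nth f k * fps_nth g l * fps_nth h (n - k - l))"
    by (rule sum.Sigma) auto
  also have "\<dots> = (\<Sum>(k,l,m) \<in> {(k,l,m). k + l + m = n}. fps_nth f k * fps_nth g l * fps_nth h m)"
    \<comment> \<open>The truncated subtraction is exact, since k + l is at most n on the
      \<open>Sigma\<close> set.\<close>
    by (rule sum.reindex_bij_witness[of _ "\<lambda>(k,l,m). (k,l)" "\<lambda>(k,l). (k,l,n - k - l)"]) auto
  finally show ?thesis .
qed

text \<open>The scalings give (vw)^k (uw)^l (uv)^m = u^(l+m) v^(k+m) w^(k+l). Dividing by
  \<open>w\<close> yields the exponent k + l - 1, which is -1 at k = l = 0, hence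
  \<open>powi\<close>.\<close>

lemma symmetric_sum_eq_fps_nth:
  assumes "d > 0" "w > 0"
  shows "symmetric_sum chi d n y z u v w = fact n / of_nat w *
    fps_nth (bernoulli_egf chi d (of_nat u * y) (of_nat (v * w)) *
      bernoulli_egf chi d (of_nat v * z) (of_nat (u * w)) *
      char_exp_sum chi (w * d) (of_nat (u * v))) n"
  unfolding symmetric_sum_def fps_nth_mult3 sum_distrib_left
  by (rule sum.cong)
    (use assms in \<open>auto simp: bernoulli_egf_def fps_nth_char_exp_sum multinomial3_def
      power_int_diff power_int_add power_add power_mult_distrib\<close>)

lemma fps_exp_minus_1_nonzero:
  "c \<noteq> 0 \<Longrightarrow> fps_exp c - 1 \<noteq> (0 :: 'a::field_char_0 fps)"
  by (metis fps_exp_0 fps_exp_eq_iff right_minus_eq)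

text \<open>The two transpositions in \<open>perm\<close> generate all permutations of the weights.
  \<open>F\<close> is the exponential generating function of the sums; its denominators are cleared
  before comparing.\<close>

lemma symmetric_sum_eq:
  assumes d: "d > 0" and pos: "u > 0" "v > 0" "w > 0" "u' > 0" "v' > 0" "w' > 0"
    and per: "\<And>a. chi (a + int d) = chi a"
    and perm: "(u', v', w') = (v, u, w) \<or> (u', v', w') = (u, w, v)"
  shows "symmetric_sum chi d n y z u v w = symmetric_sum chi d n y z u' v' w'"
proof -
  define D where "D k = fps_exp (of_nat d * of_nat k :: 'a) - 1" for k
  define A where "A k = char_exp_sum chi d (of_nat k)" for k
  define P where "P u v w = bernoulli_egf chi d (of_nat u * y) (of_nat (v * w)) *
      bernoulli_egf chi d (of_nat v * z) (of_nat (u * w)) *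
      char_exp_sum chi (w * d) (of_nat (u * v))" for u v w
  define F where "F u v w = fps_const (1 / of_nat w) * P u v w" for u v w
  have F: "D (v * w) * D (u * w) * D (u * v) * F u v w =
      fps_const (of_nat (u * v * w)) * fps_X ^ 2 * fps_exp (of_nat (u * v * w) * (y + z)) *
      D (u * v * w) * A (v * w) * A (u * w) * A (u * v)" if "w > 0" for u v w
  proof -
    have B1: "D (v * w) * bernoulli_egf chi d (of_nat u * y) (of_nat (v * w)) =
        fps_const (of_nat (v * w)) * fps_X * fps_exp (of_nat (u * v * w) * y) * A (v * w)"
      using bernoulli_egf_generating[OF d, of "of_nat (v * w)" chi "of_nat u * y"]
      by (simp add: D_def A_def mult_ac)
    have B2: "D (u * w) * bernoulli_egf chi d (of_nat v * z) (of_nat (u * w)) =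
        fps_const (of_nat (u * w)) * fps_X * fps_exp (of_nat (u * v * w) * z) * A (u * w)"
      using bernoulli_egf_generating[OF d, of "of_nat (u * w)" chi "of_nat v * z"]
      by (simp add: D_def A_def mult_ac)
    have S: "D (u * v) * char_exp_sum chi (w * d) (of_nat (u * v)) = D (u * v * w) * A (u * v)"
      using char_exp_sum_periodic[of chi d "of_nat (u * v)" w] per
      by (simp add: D_def A_def mult_ac)
    \<comment> \<open>The factor 1/w turns the asymmetric constant (vw)(uw) into the symmetric
      uvw.\<close>
    have c: "fps_const (1 / of_nat w) * (fps_const (of_nat (v * w)) * fps_const (of_nat (u * w))) =
        fps_const (of_nat (u * v * w) :: 'a)"
      using that by (simp add: mult_ac)
    have e: "fps_exp (of_nat (u * v * w) * (y + z)) =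
        fps_exp (of_nat (u * v * w) * y) * fps_exp (of_nat (u * v * w) * z)"
      by (simp add: distrib_left fps_exp_add_mult)
    have "D (v * w) * D (u * w) * D (u * v) * F u v w = fps_const (1 / of_nat w) *
        (D (v * w) * bernoulli_egf chi d (of_nat u * y) (of_nat (v * w))) *
        (D (u * w) * bernoulli_egf chi d (of_nat v * z) (of_nat (u * w))) *
        (D (u * v) * char_exp_sum chi (w * d) (of_nat (u * v)))"
      by (simp add: F_def P_def mult_ac)
    also have "\<dots> = (fps_const (1 / of_nat w) *
        (fps_const (of_nat (v * w)) * fps_const (of_nat (u * w)))) * fps_X ^ 2 *
        (fps_exp (of_nat (u * v * w) * y) * fps_exp (of_nat (u * v * w) * z)) *
        D (u * v * w) * A (v * w) * A (u * w) * A (u * v)"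
      unfolding B1 B2 S by (simp only: mult_ac power2_eq_square)
    finally show ?thesis unfolding c e .
  qed
  have D0: "D k \<noteq> 0" if "k > 0" for k
    unfolding D_def using that d by (intro fps_exp_minus_1_nonzero) simp
  \<comment> \<open>A permutation of the weights merely reorders the three factors \<open>D\<close>,
    so both sides carry the same nonzero multiplier, which then cancels.\<close>
  have "D (v * w) * D (u * w) * D (u * v) * F u v w =
      D (v * w) * D (u * w) * D (u * v) * F u' v' w'"
    using F[OF pos(3), of v u] F[OF pos(6), of v' u'] perm by (auto simp: mult_ac)
  then have "F u v w = F u' v' w'"
    using D0 pos by simp
  moreover have "symmetric_sum chi d n y z u v w = fact n * fps_nth (F u v w) n" if "w > 0" for u v w
    using symmetric_sum_eq_fps_nth[OF d that] by (simp add: F_def P_def)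
  ultimately show ?thesis using pos by simp
qed

theorem theorem2:
  fixes p d n :: nat
    and \<iota> :: "complex \<Rightarrow> 'a::{field_char_0,complete_space}"
    and chi :: "int \<Rightarrow> complex"
    and w\<^sub>1 w\<^sub>2 w\<^sub>3 :: nat
    and y\<^sub>1 y\<^sub>2 :: 'a
  assumes "prime p"
    and "is_complex_padic_field p TYPE('a)"
    and "is_embedding_of_algebraic_numbers \<iota>"
    and "d > 0"
    and "primitive_character d chi"
    and "w\<^sub>1 > 0" and "w\<^sub>2 > 0" and "w\<^sub>3 > 0"
    and "y\<^sub>1 \<in> padic_integers" and "y\<^sub>2 \<in> padic_integers"
  shows "let B = bernoulli_chi (\<iota> \<circ> chi) d; S = power_sum_chi (\<iota> \<circ> chi);
      T\<^sub>1 = (\<Sum>(k,l,m) \<in> {(k,l,m). k + l + m = n}. multinomial3 n k l m *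
            B k (of_nat w\<^sub>1 * y\<^sub>1) * B l (of_nat w\<^sub>2 * y\<^sub>2) * S m (w\<^sub>3 * d - 1) *
            of_nat w\<^sub>1 ^ (l + m) * of_nat w\<^sub>2 ^ (k + m) * of_nat w\<^sub>3 powi (int k + int l - 1));
      T\<^sub>2 = (\<Sum>(k,l,m) \<in> {(k,l,m). k + l + m = n}. multinomial3 n k l m *
            B k (of_nat w\<^sub>1 * y\<^sub>1) * B l (of_nat w\<^sub>3 * y\<^sub>2) * S m (w\<^sub>2 * d - 1) *
            of_nat w\<^sub>1 ^ (l + m) * of_nat w\<^sub>3 ^ (k + m) * of_nat w\<^sub>2 powi (int k + int l - 1));
      T\<^sub>3 = (\<Sum>(k,l,m) \<in> {(k,l,m). k + l + m = n}. multinomial3 n k l m *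
            B k (of_nat w\<^sub>2 * y\<^sub>1) * B l (of_nat w\<^sub>1 * y\<^sub>2) * S m (w\<^sub>3 * d - 1) *
            of_nat w\<^sub>2 ^ (l + m) * of_nat w\<^sub>1 ^ (k + m) * of_nat w\<^sub>3 powi (int k + int l - 1));
      T\<^sub>4 = (\<Sum>(k,l,m) \<in> {(k,l,m). k + l + m = n}. multinomial3 n k l m *
            B k (of_nat w\<^sub>2 * y\<^sub>1) * B l (of_nat w\<^sub>3 * y\<^sub>2) * S m (w\<^sub>1 * d - 1) *
            of_nat w\<^sub>2 ^ (l + m) * of_nat w\<^sub>3 ^ (k + m) * of_nat w\<^sub>1 powi (int k + int l - 1));
      T\<^sub>5 = (\<Sum>(k,l,m) \<in> {(k,l,m). k + l + m = n}. multinomial3 n k l m *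
            B k (of_nat w\<^sub>3 * y\<^sub>1) * B l (of_nat w\<^sub>2 * y\<^sub>2) * S m (w\<^sub>1 * d - 1) *
            of_nat w\<^sub>3 ^ (l + m) * of_nat w\<^sub>2 ^ (k + m) * of_nat w\<^sub>1 powi (int k + int l - 1));
      T\<^sub>6 = (\<Sum>(k,l,m) \<in> {(k,l,m). k + l + m = n}. multinomial3 n k l m *
            B k (of_nat w\<^sub>3 * y\<^sub>1) * B l (of_nat w\<^sub>1 * y\<^sub>2) * S m (w\<^sub>2 * d - 1) *
            of_nat w\<^sub>3 ^ (l + m) * of_nat w\<^sub>1 ^ (k + m) * of_nat w\<^sub>2 powi (int k + int l - 1))
    in T\<^sub>1 = T\<^sub>2 \<and> T\<^sub>2 = T\<^sub>3 \<and> T\<^sub>3 = T\<^sub>4 \<and> T\<^sub>4 = T\<^sub>5 \<and> T\<^sub>5 = T\<^sub>6"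
proof -
  define T where "T = symmetric_sum (\<iota> \<circ> chi) d n y\<^sub>1 y\<^sub>2"
  have per: "(\<iota> \<circ> chi) (a + int d) = (\<iota> \<circ> chi) a" for a
    using assms(5) by (simp add: primitive_character_def dirichlet_character_def)
  note swap = symmetric_sum_eq[where chi = "\<iota> \<circ> chi" and d = d, OF assms(4)]
  have T12: "T u v w = T v u w" and T23: "T u v w = T u w v" if "u > 0" "v > 0" "w > 0" for u v w
    unfolding T_def
    by (rule swap[OF that that(2,1,3) per], simp) (rule swap[OF that that(1,3,2) per], simp)
  note pos = assms(6-8)
  \<comment> \<open>Each link is a single transposition except the second, which passes through
    \<open>T w\<^sub>1 w\<^sub>2 w\<^sub>3\<close> and so composes \<open>T23\<close> with
    \<open>T12\<close>.\<close>
  have "T w\<^sub>1 w\<^sub>2 w\<^sub>3 = T w\<^sub>1 w\<^sub>3 w\<^sub>2 \<and> T w\<^sub>1 w\<^sub>3 w\<^sub>2 = T w\<^sub>2 w\<^sub>1 w\<^sub>3 \<and> T w\<^sub>2 w\<^sub>1 w\<^sub>3 = T w\<^sub>2 w\<^sub>3 w\<^sub>1 \<and>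
      T w\<^sub>2 w\<^sub>3 w\<^sub>1 = T w\<^sub>3 w\<^sub>2 w\<^sub>1 \<and> T w\<^sub>3 w\<^sub>2 w\<^sub>1 = T w\<^sub>3 w\<^sub>1 w\<^sub>2"
    using T23[OF pos] trans[OF T23[OF pos(1,3,2)] T12[OF pos]] T23[OF pos(2,1,3)]
      T12[OF pos(2,3,1)] T23[OF pos(3,2,1)] by (intro conjI)
  then show ?thesis
    unfolding T_def symmetric_sum_def Let_def .
qed

end
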